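(* Let $\varphi$ be a hyperbolic linear fractional self-map of $B_N$ with boundary dilation coefficient $\alpha$. (i) If $\varphi$ fixes only one boundary point (point of $\partial B_N$), then $\varphi$ is conjugated to a map $\phi$ of the form $$\phi(z,w)=\frac1\alpha(z+c,\,Aw+d),\qquad (z,w)\in H_N,$$ where $c\in\mathbb{R}$, $d\in\mathbb{C}^{N-1}$ with $\alpha c\ge|d|^2$, and $A\in\mathbb{C}^{(N-1)\times(N-1)}$ satisfies $\|A\|\le\sqrt\alpha$. (ii) If $\varphi$ fixes two boundary points, then $\varphi$ is conjugated to a map $\phi$ of the form $$\phi(z,w)=\Bigl(\frac{z}{\alpha},\frac{Aw}{\sqrt\alpha}\Bigr),\qquad (z,w)\in H_N,$$ where $A$ is a matrix of order $N-1$ with $\|A\|\le1$.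
   Context: $B_N$ is the open Euclidean unit ball of $\mathbb{C}^N$. A linear fractional self-map of $B_N$ is a map $\varphi(z)=\frac{Mz+B}{\langle z,C\rangle+e}$ ($M\in\mathbb{C}^{N\times N}$, $B,C\in\mathbb{C}^N$, $e\in\mathbb{C}$) mapping $B_N$ into itself; it extends holomorphically to a neighbourhood of $\overline{B_N}$. If such $\varphi$ has no fixed point in $B_N$, there is a unique $\tau\in\partial B_N$ (the Denjoy–Wolff point) with $\varphi(\tau)=\tau$ and $\langle d\varphi_\tau(\tau),\tau\rangle=\alpha$ with $0<\alpha\le1$; $\alpha$ is the boundary dilation coefficient. $\varphi$ is hyperbolic if it has no fixed point in $B_N$ and $\alpha\in(0,1)$; a hyperbolic map has one or two fixed points on $\partial B_N$. $H_N=\{(z,w)\in\mathbb{C}\times\mathbb{C}^{N-1}:\mathrm{Re}\,z>|w|^2\}$ is the Siegel half-plane, biholomorphic to $B_N$ via the Cayley transform $\sigma_C(z,w)=\bigl(\frac{1+z}{1-z},\frac{w}{1-z}\bigr)$. "$\varphi$ is conjugated to $\phi$ on $H_N$" means there is a biholomorphic map $\sigma$ from $B_N$ onto $H_N$ with $\sigma\circ\varphi=\phi\circ\sigma$. $\|A\|$ is the operator norm with respect to the Euclidean norm. *)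

theory Defs
  imports "HOL-Analysis.Analysis"
begin

definition hinner :: "complex^'n \<Rightarrow> complex^'n \<Rightarrow> complex" where
  "hinner z w = (\<Sum>i\<in>UNIV. z $ i * cnj (w $ i))"

(* The rational formula is used as a total function on C^N, so that it is also the holomorphic
   extension of the map of the ball to a neighbourhood of the closed ball. Where the denominator
   vanishes the value is 0, hence such a point is never a fixed point on the unit sphere. *)
definition lin_frac ::
  "complex^'n^'n \<Rightarrow> complex^'n \<Rightarrow> complex^'n \<Rightarrow> complex \<Rightarrow> complex^'n \<Rightarrow> complex^'n" where
  "lin_frac M B C e z = (1 / (hinner z C + e)) *s (M *v z + B)"

definition linear_fractional_self_map :: "(complex^'n \<Rightarrow> complex^'n) \<Rightarrow> bool" where
  "linear_fractional_self_map \<phi> \<longleftrightarrow>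
     (\<exists>M B C e. \<phi> = lin_frac M B C e \<and> (\<forall>z\<in>ball 0 1. hinner z C + e \<noteq> 0)) \<and>
     \<phi> ` ball 0 1 \<subseteq> ball 0 1"

definition denjoy_wolff_point :: "(complex^'n \<Rightarrow> complex^'n) \<Rightarrow> complex^'n \<Rightarrow> real \<Rightarrow> bool" where
  "denjoy_wolff_point \<phi> \<tau> \<alpha> \<longleftrightarrow>
     \<tau> \<in> sphere 0 1 \<and> \<phi> \<tau> = \<tau> \<and> 0 < \<alpha> \<and> \<alpha> \<le> 1 \<and>
     hinner (frechet_derivative \<phi> (at \<tau>) \<tau>) \<tau> = complex_of_real \<alpha>"

(* The Denjoy-Wolff point, hence alpha, is unique for maps without interior fixed points, so
   alpha is carried as a parameter: hyperbolic with boundary dilation coefficient alpha. *)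
definition hyperbolic :: "(complex^'n \<Rightarrow> complex^'n) \<Rightarrow> real \<Rightarrow> bool" where
  "hyperbolic \<phi> \<alpha> \<longleftrightarrow>
     (\<forall>z\<in>ball 0 1. \<phi> z \<noteq> z) \<and> (\<exists>\<tau>. denjoy_wolff_point \<phi> \<tau> \<alpha>) \<and> \<alpha> < 1"

definition boundary_fixed_points :: "(complex^'n \<Rightarrow> complex^'n) \<Rightarrow> (complex^'n) set" where
  "boundary_fixed_points \<phi> = {\<zeta> \<in> sphere 0 1. \<phi> \<zeta> = \<zeta>}"

(* The splitting C^N = C x C^(N-1) is taken inside complex^'n, so that N = 1 is covered:
   z is the coordinate k, and w in C^(N-1) is a vector whose k-th coordinate is 0.
   Accordingly, a matrix of order N - 1 is one whose k-th row and column are 0; this padding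
   changes neither its action on C^(N-1) nor its operator norm. *)
definition tail_space :: "'n \<Rightarrow> (complex^'n) set" where
  "tail_space k = {w. w $ k = 0}"

definition tail_matrices :: "'n \<Rightarrow> (complex^'n^'n) set" where
  "tail_matrices k = {A. \<forall>i. A $ k $ i = 0 \<and> A $ i $ k = 0}"

definition tail :: "'n \<Rightarrow> complex^'n \<Rightarrow> complex^'n" where
  "tail k x = (\<chi> i. if i = k then 0 else x $ i)"

definition join :: "'n \<Rightarrow> complex \<Rightarrow> complex^'n \<Rightarrow> complex^'n" where
  "join k z w = (\<chi> i. if i = k then z else w $ i)"

definition siegel :: "'n \<Rightarrow> (complex^'n) set" where
  "siegel k = {x. Re (x $ k) > (norm (tail k x))\<^sup>2}"

definition holomorphic_map_on :: "(complex^'n \<Rightarrow> complex^'n) \<Rightarrow> (complex^'n) set \<Rightarrow> bool" where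
  "holomorphic_map_on f S \<longleftrightarrow>
     (\<forall>x\<in>S. \<exists>D. (f has_derivative D) (at x) \<and> (\<forall>c v. D (c *s v) = c *s D v))"

definition biholomorphic ::
  "(complex^'n) set \<Rightarrow> (complex^'n) set \<Rightarrow> (complex^'n \<Rightarrow> complex^'n) \<Rightarrow> bool" where
  "biholomorphic S T \<sigma> \<longleftrightarrow>
     bij_betw \<sigma> S T \<and> holomorphic_map_on \<sigma> S \<and> holomorphic_map_on (inv_into S \<sigma>) T"

definition conjugated_on_siegel ::
  "'n \<Rightarrow> (complex^'n \<Rightarrow> complex^'n) \<Rightarrow> (complex^'n \<Rightarrow> complex^'n) \<Rightarrow> bool" where
  "conjugated_on_siegel k \<phi> \<psi> \<longleftrightarrow>
     (\<exists>\<sigma>. biholomorphic (ball 0 1) (siegel k) \<sigma> \<and> (\<forall>x\<in>ball 0 1. \<sigma> (\<phi> x) = \<psi> (\<sigma> x)))"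

end

theory Submission imports Defs begin

text \<open>A unitary map followed by the Cayley transform sends the Denjoy-Wolff point to infinity. The
  conjugated map fixes infinity and preserves the Siegel half-plane, which forces it to be affine,
  \<open>(z, w) \<mapsto> (z / \<alpha> + \<langle>w, b\<rangle> + c, A w + d)\<close>, with \<open>\<parallel>A\<parallel>\<^sup>2 \<le> 1 / \<alpha>\<close>. Conjugating by the
  Heisenberg translation \<open>(z, w) \<mapsto> (z + 2 \<langle>w, a\<rangle> + |a|\<^sup>2 + i t, w + a)\<close> replaces \<open>b\<close> by
  \<open>b - 2 a / \<alpha> + 2 A\<^sup>* a\<close>. Since \<open>\<parallel>A\<parallel> < 1 / \<alpha>\<close>, a suitable \<open>a\<close> makes this vanish, and then \<open>t\<close>
  makes \<open>c\<close> real. If there is a second boundary fixed point, one translates it to the origin instead,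
  so that \<open>c = d = 0\<close>, and invariance of the half-plane forces \<open>b = 0\<close>.\<close>

section \<open>The Hermitian inner product and unitary matrices\<close>

lemma hinner_add_left: "hinner (x + y) z = hinner x z + hinner y z"
  by (simp add: hinner_def distrib_right sum.distrib)

lemma hinner_add_right: "hinner x (y + z) = hinner x y + hinner x z"
  by (simp add: hinner_def distrib_left sum.distrib)

lemma hinner_diff_left: "hinner (x - y) z = hinner x z - hinner y z"
  by (simp add: hinner_def left_diff_distrib sum_subtractf)

lemma hinner_diff_right: "hinner x (y - z) = hinner x y - hinner x z"
  by (simp add: hinner_def right_diff_distrib sum_subtractf)

lemma hinner_scale_left: "hinner (c *s x) y = c * hinner x y"
  by (simp add: hinner_def sum_distrib_left mult.assoc)

lemma hinner_scale_right: "hinner x (c *s y) = cnj c * hinner x y"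
  by (simp add: hinner_def sum_distrib_left algebra_simps)

lemma hinner_zero_left [simp]: "hinner 0 y = 0"
  by (simp add: hinner_def)

lemma hinner_zero_right [simp]: "hinner x 0 = 0"
  by (simp add: hinner_def)

lemma hinner_minus_left [simp]: "hinner (- x) y = - hinner x y"
  by (simp add: hinner_def sum_negf)

lemma hinner_minus_right [simp]: "hinner x (- y) = - hinner x y"
  by (simp add: hinner_def sum_negf)

lemmas hinner_simps = hinner_add_left hinner_add_right hinner_diff_left hinner_diff_right
  hinner_scale_left hinner_scale_right

lemma hinner_commute: "hinner y x = cnj (hinner x y)"
  by (simp add: hinner_def mult.commute)

lemma hinner_axis_right [simp]: "hinner x (axis k 1) = x $ k"
  by (simp add: hinner_def axis_def if_distrib sum.delta cong: if_cong)

lemma hinner_axis_left [simp]: "hinner (axis k 1) x = cnj (x $ k)"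
  by (simp add: hinner_commute [of "axis k 1" x])

lemma hinner_self: "hinner x x = complex_of_real ((norm x)\<^sup>2)"
proof -
  have "hinner x x = (\<Sum>i\<in>UNIV. complex_of_real ((cmod (x $ i))\<^sup>2))"
    by (simp add: hinner_def complex_norm_square del: of_real_power)
  then show ?thesis
    by (simp add: norm_vec_def L2_set_def sum_nonneg)
qed

lemma norm_hinner_le: "cmod (hinner x y) \<le> norm x * norm y"
proof -
  have "cmod (hinner x y) \<le> (\<Sum>i\<in>UNIV. \<bar>cmod (x $ i)\<bar> * \<bar>cmod (y $ i)\<bar>)"
    unfolding hinner_def by (rule order_trans [OF norm_sum]) (simp add: norm_mult)
  also have "\<dots> \<le> norm x * norm y"
    unfolding norm_vec_def by (rule L2_set_mult_ineq)
  finally show ?thesis .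
qed

lemma norm_vector_scalar_mult [simp]: "norm (c *s (x :: complex^'n)) = cmod c * norm x"
  by (simp add: norm_vec_def norm_mult L2_set_right_distrib)

lemma eq_if_hinner_eq:
  assumes "\<And>x. hinner x y = hinner x z"
  shows "y = z"
proof -
  have "hinner (y - z) (y - z) = 0"
    using assms [of "y - z"] by (simp add: hinner_diff_right)
  then show ?thesis
    by (simp add: hinner_self)
qed

definition adj :: "complex^'n^'n \<Rightarrow> complex^'n^'n" where
  "adj A = (\<chi> i j. cnj (A $ j $ i))"

lemma hinner_adj: "hinner (A *v x) y = hinner x (adj A *v y)"
proof -
  have "hinner (A *v x) y = (\<Sum>i\<in>UNIV. \<Sum>j\<in>UNIV. A $ i $ j * x $ j * cnj (y $ i))"
    by (simp add: hinner_def matrix_vector_mult_def sum_distrib_right)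
  also have "\<dots> = (\<Sum>j\<in>UNIV. \<Sum>i\<in>UNIV. A $ i $ j * x $ j * cnj (y $ i))"
    by (rule sum.swap)
  also have "\<dots> = hinner x (adj A *v y)"
    by (simp add: hinner_def matrix_vector_mult_def adj_def sum_distrib_left algebra_simps)
  finally show ?thesis .
qed

lemmas matrix_vector_simps = vector_scalar_commute matrix_vector_right_distrib
  matrix_vector_mult_diff_distrib

lemma complex_linear_matrix:
  fixes f :: "complex^'n \<Rightarrow> complex^'n"
  assumes "\<And>x y. f (x + y) = f x + f y" and "\<And>c x. f (c *s x) = c *s f x"
  shows "matrix f *v x = f x"
  by (rule matrix_works, unfold_locales) (simp_all add: assms vector_add_ldistrib vector_sadd_rdistrib)

text \<open>A Householder reflection takes \<^term>\<open>\<tau>\<close> to a unimodular multiple of a basis vector; if the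
  two already agree, then \<^term>\<open>v = 0\<close> and the junk value of the division makes it the identity.\<close>

lemma exists_unitary:
  fixes \<tau> :: "complex^'n"
  assumes "norm \<tau> = 1"
  obtains U where "\<And>x y. hinner (U *v x) (U *v y) = hinner x y" and "U *v \<tau> = axis k 1"
    and "\<And>x. U *v (adj U *v x) = x" and "\<And>x. adj U *v (U *v x) = x"
proof -
  \<comment> \<open>\<theta> is the phase of the \<open>k\<close>-th coordinate, so that the inner
    product of \<tau> with \<open>\<theta> *s axis k 1\<close> is real, as it must be if a
    Householder reflection is to exchange these unit vectors. If the coordinate vanishes, every
    phase has this property and 1 is taken.\<close>
  define \<theta> where "\<theta> = (if \<tau> $ k = 0 then 1 else sgn (\<tau> $ k))"
  have \<theta>: "cnj \<theta> * \<theta> = 1"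
    by (metis \<theta>_def complex_norm_square mult.commute mult_1 norm_one norm_sgn of_real_1 one_power2)
  have \<tau>k: "cnj \<theta> * \<tau> $ k = of_real (cmod (\<tau> $ k))"
    using \<theta> unfolding \<theta>_def
    by (auto simp: sgn_eq field_simps complex_norm_square power2_eq_square)
  define v where "v = \<tau> - \<theta> *s axis k 1"
  define s where "s = complex_of_real (2 / (norm v)\<^sup>2)"
  define f where "f x = cnj \<theta> *s (x - (s * hinner x v) *s v)" for x
  \<comment> \<open>The extra factor \<open>s\<close> makes this true also for \<open>v = 0\<close>,
    where division by zero gives \<open>s = 0\<close>; so \<open>f_inner\<close> covers both cases
    at once.\<close>
  have s: "s * (s * hinner v v) = 2 * s"
    by (simp add: s_def hinner_self field_simps power2_eq_square)
  have cs: "cnj s = s"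
    by (simp add: s_def)
  have \<theta>': "\<theta> * (cnj \<theta> * x) = x" for x
    using \<theta> by (metis mult.assoc mult.commute mult_1)
  have f_add: "f (x + y) = f x + f y" for x y
    by (simp add: f_def hinner_simps vec_eq_iff algebra_simps)
  have f_scale: "f (c *s x) = c *s f x" for c x
    by (simp add: f_def hinner_simps vec_eq_iff algebra_simps)
  have f_inner: "hinner (f x) (f y) = hinner x y" for x y
  proof -
    have "hinner (f x) (f y) = hinner (x - (s * hinner x v) *s v) (y - (s * hinner y v) *s v)"
      using \<theta> by (simp only: f_def hinner_scale_left hinner_scale_right complex_cnj_cnj)
        (simp add: mult.commute flip: mult.assoc)
    also have "\<dots> = hinner x y - 2 * s * hinner x v * cnj (hinner y v)
        + (s * (s * hinner v v)) * hinner x v * cnj (hinner y v)"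
      by (simp add: hinner_simps cs hinner_commute [of v y] algebra_simps)
    finally show ?thesis
      by (simp add: s)
  qed
  have f_\<tau>: "f \<tau> = axis k 1"
  proof (cases "v = 0")
    case True
    then have "\<tau> = \<theta> *s axis k 1"
      by (simp add: v_def)
    with True \<theta> show ?thesis
      by (simp add: f_def vec_eq_iff)
  next
    case False
    have hv: "hinner \<tau> v = 1 - of_real (cmod (\<tau> $ k))"
      using assms \<tau>k by (simp add: v_def hinner_simps hinner_self)
    have "\<theta> * cnj (\<tau> $ k) = of_real (cmod (\<tau> $ k))"
      using arg_cong [OF \<tau>k, of cnj] by simp
    \<comment> \<open>For unit vectors with real inner product, <v, v> = 2 <\<tau>, v>, so the
      reflection subtracts exactly \<open>v\<close> from \<tau>.\<close>
    then have "hinner v v = 2 * hinner \<tau> v"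
      using \<tau>k \<theta> hinner_self [of \<tau>] assms unfolding hv v_def
      by (simp add: hinner_simps algebra_simps)
    moreover have "s * hinner v v = 2"
      using False by (simp add: s_def hinner_self)
    ultimately have "s * hinner \<tau> v = 1"
      by simp
    then show ?thesis
      using \<theta> by (simp add: f_def v_def vec_eq_iff)
  qed
  define U where "U = matrix f"
  have U: "U *v x = f x" for x
    unfolding U_def by (rule complex_linear_matrix [OF f_add f_scale])
  have VU: "adj U *v (U *v x) = x" for x
    by (rule eq_if_hinner_eq) (simp add: hinner_adj [symmetric] U f_inner)
  then have "adj U ** U = mat 1"
    by (simp add: matrix_eq matrix_vector_mul_assoc [symmetric])
  then have "U ** adj U = mat 1"
    by (simp add: matrix_left_right_inverse)
  then have UV: "U *v (adj U *v x) = x" for x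
    by (simp add: matrix_vector_mul_assoc)
  show thesis
    by (rule that [of U]) (use f_inner f_\<tau> U UV VU in auto)
qed

section \<open>Fractional and biholomorphic maps\<close>

lemma bounded_bilinear_vector_scalar_mult:
  "bounded_bilinear ((*s) :: complex \<Rightarrow> complex^'n \<Rightarrow> complex^'n)"
  by unfold_locales
    (auto simp: vec_eq_iff algebra_simps intro!: exI [of _ 1])

lemma linear_hinner: "linear (\<lambda>x. hinner x C)"
  by (rule linearI) (auto simp: hinner_def sum.distrib algebra_simps scaleR_sum_right)

lemma fractional_has_derivative:
  fixes L :: "complex^'n \<Rightarrow> complex^'n" and l :: "complex^'n \<Rightarrow> complex"
  assumes "linear L" and "linear l" and "l x + e \<noteq> 0"
  shows "((\<lambda>z. (1 / (l z + e)) *s (L z + B)) has_derivative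
    (\<lambda>v. (1 / (l x + e)) *s L v + (- (l v / (l x + e)\<^sup>2)) *s (L x + B))) (at x)"
proof -
  have L: "(L has_derivative L) (at x)" and l: "(l has_derivative l) (at x)"
    using assms(1,2) by (simp_all add: linear_conv_bounded_linear bounded_linear_imp_has_derivative)
  have "((\<lambda>z. 1 / (l z + e)) has_derivative (\<lambda>v. - (l v / (l x + e)\<^sup>2))) (at x)"
    by (rule derivative_eq_intros l assms(3) refl)+
      (use assms(3) in \<open>auto simp: field_simps power2_eq_square\<close>)
  moreover have "((\<lambda>z. L z + B) has_derivative L) (at x)"
    using has_derivative_add_const [OF L] .
  ultimately show ?thesis
    by (rule bounded_bilinear.FDERIV [OF bounded_bilinear_vector_scalar_mult])
qed

text \<open>\<open>linear\<close> is linearity over the reals, so compatibility with complex scalars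
  is assumed separately; the quotient rule passes it on to the derivative.\<close>

lemma holomorphic_map_on_fractional:
  fixes L :: "complex^'n \<Rightarrow> complex^'n" and l :: "complex^'n \<Rightarrow> complex"
  assumes "linear L" and "linear l" and "\<And>c v. L (c *s v) = c *s L v" and "\<And>c v. l (c *s v) = c * l v"
    and "\<And>x. x \<in> S \<Longrightarrow> l x + e \<noteq> 0"
  shows "holomorphic_map_on (\<lambda>z. (1 / (l z + e)) *s (L z + B)) S"
  unfolding holomorphic_map_on_def
proof
  fix x
  assume "x \<in> S"
  then show "\<exists>D. ((\<lambda>z. (1 / (l z + e)) *s (L z + B)) has_derivative D) (at x) \<and>
    (\<forall>c v. D (c *s v) = c *s D v)"
    by (intro exI conjI) (rule fractional_has_derivative [OF assms(1,2,5)],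
      auto simp: assms(3,4) vec_eq_iff algebra_simps)
qed

lemma holomorphic_map_on_affine:
  fixes L :: "complex^'n \<Rightarrow> complex^'n"
  assumes "linear L" and "\<And>c v. L (c *s v) = c *s L v"
  shows "holomorphic_map_on (\<lambda>z. L z + B) S"
  using holomorphic_map_on_fractional [of L "\<lambda>_. 0" S 1 B] assms
  by (simp add: module_hom_zero)

lemma holomorphic_map_on_compose:
  assumes "holomorphic_map_on f S" and "holomorphic_map_on g T" and "f ` S \<subseteq> T"
  shows "holomorphic_map_on (\<lambda>x. g (f x)) S"
  unfolding holomorphic_map_on_def
proof
  fix x
  assume x: "x \<in> S"
  obtain D where D: "(f has_derivative D) (at x)" "\<And>c v. D (c *s v) = c *s D v"
    using assms(1) x by (auto simp: holomorphic_map_on_def)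
  obtain D' where D': "(g has_derivative D') (at (f x))" "\<And>c v. D' (c *s v) = c *s D' v"
    using assms(2,3) x by (fastforce simp: holomorphic_map_on_def)
  show "\<exists>D. ((\<lambda>x. g (f x)) has_derivative D) (at x) \<and> (\<forall>c v. D (c *s v) = c *s D v)"
    by (intro exI [of _ "\<lambda>v. D' (D v)"] conjI has_derivative_compose [OF D(1) D'(1)])
      (simp add: D(2) D'(2))
qed

text \<open>\<open>inv_into S f\<close> agrees with \<open>g\<close> only on \<open>T\<close>, while
  \<open>holomorphic_map_on\<close> asks for derivatives in the full space. Openness of
  \<open>T\<close> lets the derivative of \<open>g\<close> be transferred.\<close>

lemma biholomorphicI:
  assumes "open T" and "holomorphic_map_on f S" and "holomorphic_map_on g T"
    and "\<And>x. x \<in> S \<Longrightarrow> f x \<in> T" and "\<And>y. y \<in> T \<Longrightarrow> g y \<in> S"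
    and "\<And>x. x \<in> S \<Longrightarrow> g (f x) = x" and "\<And>y. y \<in> T \<Longrightarrow> f (g y) = y"
  shows "biholomorphic S T f"
proof -
  have bij: "bij_betw f S T"
    by (rule bij_betw_byWitness [where f' = g]) (use assms in auto)
  have inv: "g y = inv_into S f y" if "y \<in> T" for y
    using that assms bij by (metis bij_betw_inv_into_left)
  have "holomorphic_map_on (inv_into S f) T"
    unfolding holomorphic_map_on_def
  proof
    fix y
    assume y: "y \<in> T"
    obtain D where D: "(g has_derivative D) (at y)" "\<forall>c v. D (c *s v) = c *s D v"
      using assms(3) y by (auto simp: holomorphic_map_on_def)
    have "(inv_into S f has_derivative D) (at y)"
      using D(1) assms(1) y inv by (rule has_derivative_transform_within_open)
    with D(2) show "\<exists>D. (inv_into S f has_derivative D) (at y) \<and> (\<forall>c v. D (c *s v) = c *s D v)"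
      by blast
  qed
  with bij assms(2) show ?thesis
    by (simp add: biholomorphic_def)
qed

section \<open>The Siegel half-plane\<close>

lemma in_tail_space_iff [simp]: "w \<in> tail_space k \<longleftrightarrow> w $ k = 0"
  by (simp add: tail_space_def)

lemma tail_eq: "tail k x = x - x $ k *s axis k 1"
  by (simp add: vec_eq_iff tail_def axis_def)

lemma tail_ident [simp]: "w \<in> tail_space k \<Longrightarrow> tail k w = w"
  by (simp add: tail_eq)

lemma tail_nth [simp]: "tail k x $ k = 0"
  by (simp add: tail_def)

lemma tail_add: "tail k (x + y) = tail k x + tail k y"
  and tail_diff: "tail k (x - y) = tail k x - tail k y"
  and tail_scale: "tail k (c *s x) = c *s tail k x"
  and tail_axis [simp]: "tail k (axis k a) = 0"
  by (simp_all add: tail_def axis_def vec_eq_iff)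

lemma norm_eq_tail: "(norm x)\<^sup>2 = (cmod (x $ k))\<^sup>2 + (norm (tail k x))\<^sup>2"
proof -
  have "complex_of_real ((norm (tail k x))\<^sup>2) = hinner x x - x $ k * cnj (x $ k)"
    by (simp only: hinner_self [symmetric]) (simp add: tail_eq hinner_simps)
  also have "\<dots> = complex_of_real ((norm x)\<^sup>2 - (cmod (x $ k))\<^sup>2)"
    by (simp only: hinner_self complex_norm_square [symmetric] of_real_diff)
  finally show ?thesis
    by (simp only: of_real_eq_iff)
qed

text \<open>A defining function of the half-plane: positive inside, zero on the finite boundary. Its
  exact value serves to locate a boundary fixed point as well.\<close>

definition siegel_height :: "'n \<Rightarrow> complex^'n \<Rightarrow> real" where
  "siegel_height k x = Re (x $ k) - (norm (tail k x))\<^sup>2"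

lemma siegel_iff: "x \<in> siegel k \<longleftrightarrow> siegel_height k x > 0"
  by (simp add: siegel_def siegel_height_def)

lemma open_siegel: "open (siegel k :: (complex^'n) set)"
proof -
  have "continuous_on UNIV (siegel_height k :: complex^'n \<Rightarrow> real)"
    unfolding siegel_height_def tail_def
  proof (intro continuous_intros continuous_on_vec_lambda)
    show "continuous_on UNIV (\<lambda>x :: complex^'n. if i = k then 0 else x $ i)" for i
      by (cases "i = k") (auto intro!: continuous_intros)
  qed
  then have "open {x :: complex^'n. 0 < siegel_height k x}"
    by (intro open_Collect_less continuous_intros) auto
  moreover have "{x :: complex^'n. 0 < siegel_height k x} = siegel k"
    by (auto simp: siegel_iff)
  ultimately show ?thesis
    by simp
qed

section \<open>The Cayley transform, which sends the \<open>k\<close>-th basis vector to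
  infinity\<close>

definition cayley :: "'n \<Rightarrow> complex^'n \<Rightarrow> complex^'n" where
  "cayley k z = (1 / (1 - z $ k)) *s (z + axis k 1)"

text \<open>In coordinates this is ((z - 1) / (z + 1), 2 w / (z + 1)). Both transforms are written
  as one scalar times an affine vector expression, which fits
  \<open>holomorphic_map_on_fractional\<close>.\<close>

definition cayley_inv :: "'n \<Rightarrow> complex^'n \<Rightarrow> complex^'n" where
  "cayley_inv k x = (1 / (x $ k + 1)) *s (2 *s x - x $ k *s axis k 1 - axis k 1)"

lemma cayley_inv_cayley:
  assumes "z $ k \<noteq> 1"
  shows "cayley_inv k (cayley k z) = z"
proof -
  define u where "u = 1 - z $ k"
  have u: "u \<noteq> 0" and zk: "z $ k = 1 - u"
    using assms by (simp_all add: u_def)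
  have k: "cayley k z $ k = 2 / u - 1"
    using u by (simp add: cayley_def zk field_simps)
  show ?thesis
    using u by (simp add: cayley_inv_def k) (simp add: cayley_def zk vec_eq_iff axis_def field_simps)
qed

lemma one_minus_cayley_inv:
  assumes "x $ k + 1 \<noteq> 0"
  shows "1 - cayley_inv k x $ k = 2 / (x $ k + 1)"
  using assms by (simp add: cayley_inv_def field_simps)

lemma cayley_cayley_inv:
  assumes "x $ k + 1 \<noteq> 0"
  shows "cayley k (cayley_inv k x) = x"
proof -
  define u where "u = x $ k + 1"
  have u: "u \<noteq> 0" and xk: "x $ k = u - 1"
    using assms by (simp_all add: u_def)
  have "cayley_inv k x + axis k 1 = (2 / u) *s x"
    using u by (simp add: cayley_inv_def xk vec_eq_iff axis_def field_simps)
  then show ?thesis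
    unfolding cayley_def one_minus_cayley_inv [OF assms] using u by (simp add: xk)
qed

text \<open>The real part of (1 + z) / (1 - z) is (1 - |z|^2) / |1 - z|^2, and subtracting |w|^2 /
  |1 - z|^2 completes the norm. Unit vectors off the pole therefore land at height 0.\<close>

lemma siegel_height_cayley:
  assumes "z $ k \<noteq> 1"
  shows "siegel_height k (cayley k z) = (1 - (norm z)\<^sup>2) / (cmod (1 - z $ k))\<^sup>2"
proof -
  have "Re ((1 / (1 - z $ k)) * (z $ k + 1)) = (1 - (cmod (z $ k))\<^sup>2) / (cmod (1 - z $ k))\<^sup>2"
    unfolding cmod_power2 by (simp add: Re_divide algebra_simps power2_eq_square)
  then show ?thesis
    by (simp add: siegel_height_def cayley_def tail_scale tail_add norm_divide power_divide
      norm_eq_tail [of z k] diff_divide_distrib add_divide_distrib)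
qed

lemma nth_neq_1:
  assumes "norm z < 1"
  shows "z $ k \<noteq> (1 :: complex)"
  using assms Finite_Cartesian_Product.norm_nth_le [of z k] by auto

lemma siegel_nth:
  assumes "x \<in> siegel k"
  shows "x $ k + 1 \<noteq> 0"
proof -
  have "0 < Re (x $ k + 1)"
    using assms zero_le_power2 [of "norm (tail k x)"] unfolding siegel_def mem_Collect_eq
    by (simp only: plus_complex.simps one_complex.simps)
  then show ?thesis
    by (metis less_irrefl zero_complex.simps(1))
qed

lemma cayley_in_siegel:
  assumes "norm z < 1"
  shows "cayley k z \<in> siegel k"
  using assms nth_neq_1 [OF assms, of k]
  by (simp add: siegel_iff siegel_height_cayley power_less_one_iff abs_square_less_1)

text \<open>This is \<open>siegel_height_cayley\<close> read backwards: positive height forces a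
  positive numerator.\<close>

lemma norm_cayley_inv:
  assumes "x \<in> siegel k"
  shows "norm (cayley_inv k x) < 1"
proof -
  have x: "x $ k + 1 \<noteq> 0"
    using siegel_nth [OF assms] .
  then have "cayley_inv k x $ k \<noteq> 1"
    using one_minus_cayley_inv [of x k] by auto
  then have "0 < (1 - (norm (cayley_inv k x))\<^sup>2) / (cmod (1 - cayley_inv k x $ k))\<^sup>2"
    using siegel_height_cayley assms cayley_cayley_inv [OF x] siegel_iff by metis
  then have "(norm (cayley_inv k x))\<^sup>2 < 1"
    by (simp add: zero_less_divide_iff)
  then show ?thesis
    by (simp add: abs_square_less_1)
qed

lemma holomorphic_cayley: "holomorphic_map_on (cayley k) (ball 0 1)"
proof -
  have "holomorphic_map_on (\<lambda>z. (1 / (- z $ k + 1)) *s (z + axis k 1)) (ball 0 1)"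
    by (rule holomorphic_map_on_fractional)
      (auto intro: linearI dest: nth_neq_1 [of _ k])
  then show ?thesis
    by (simp add: cayley_def [abs_def])
qed

lemma holomorphic_cayley_inv: "holomorphic_map_on (cayley_inv k) (siegel k)"
proof -
  have "holomorphic_map_on
      (\<lambda>x. (1 / (x $ k + 1)) *s ((2 *s x - x $ k *s axis k 1) + (- axis k 1))) (siegel k)"
    by (rule holomorphic_map_on_fractional)
      (use siegel_nth in \<open>auto intro!: linearI simp: vec_eq_iff algebra_simps\<close>)
  then show ?thesis
    by (simp add: cayley_inv_def [abs_def])
qed

section \<open>Heisenberg translations of the half-plane\<close>

definition heisenberg :: "'n \<Rightarrow> complex^'n \<Rightarrow> real \<Rightarrow> complex^'n \<Rightarrow> complex^'n" where
  "heisenberg k a t x =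
     x + (2 * hinner x a + of_real ((norm a)\<^sup>2) + \<i> * of_real t) *s axis k 1 + a"

lemma heisenberg_heisenberg:
  assumes "a \<in> tail_space k"
  shows "heisenberg k (- a) (- t) (heisenberg k a t x) = x"
proof -
  have "hinner a a = of_real ((norm a)\<^sup>2)"
    by (rule hinner_self)
  then show ?thesis
    using assms unfolding heisenberg_def
    by (simp add: hinner_simps vec_eq_iff algebra_simps)
qed

text \<open>Expanding |w + a|^2 produces 2 Re <w, a> + |a|^2, exactly what the translation adds to
  the real part of the \<open>k\<close>-th coordinate.\<close>

lemma siegel_height_heisenberg:
  assumes "a \<in> tail_space k"
  shows "siegel_height k (heisenberg k a t x) = siegel_height k x"
proof -
  have k: "heisenberg k a t x $ k = x $ k + 2 * hinner x a + of_real ((norm a)\<^sup>2) + \<i> * of_real t"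
    and tail: "tail k (heisenberg k a t x) = tail k x + a"
    using assms by (simp_all add: heisenberg_def tail_add tail_scale)
  have "hinner (tail k x) a = hinner x a"
    using assms by (simp add: tail_eq hinner_simps)
  then have "complex_of_real ((norm (tail k x + a))\<^sup>2) =
      of_real ((norm (tail k x))\<^sup>2) + hinner x a + cnj (hinner x a) + of_real ((norm a)\<^sup>2)"
    unfolding hinner_self [symmetric]
    by (simp add: hinner_simps hinner_commute [of a "tail k x"])
  from arg_cong [OF this, of Re] show ?thesis
    by (simp add: siegel_height_def k tail del: of_real_power)
qed

lemma holomorphic_heisenberg: "holomorphic_map_on (heisenberg k a t) S"
proof -
  have "holomorphic_map_on (\<lambda>x. (x + (2 * hinner x a) *s axis k 1)
      + ((of_real ((norm a)\<^sup>2) + \<i> * of_real t) *s axis k 1 + a)) S"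
    by (rule holomorphic_map_on_affine)
      (auto intro!: linearI simp: hinner_simps linear_cmul [OF linear_hinner] vec_eq_iff algebra_simps)
  then show ?thesis
    by (simp add: heisenberg_def [abs_def] vector_sadd_rdistrib add.assoc)
qed

section \<open>Affine self-maps of the Siegel half-plane\<close>

lemma tail_matrices_mult:
  assumes "A \<in> tail_matrices k"
  shows tail_matrices_nth: "(A *v x) $ k = 0"
    and tail_matrices_axis: "A *v axis k c = 0"
    and tail_matrices_tail: "A *v tail k x = A *v x"
    and tail_matrices_in_tail_space: "A *v x \<in> tail_space k"
proof -
  show "(A *v x) $ k = 0"
    using assms by (simp add: matrix_vector_mult_def tail_matrices_def)
  then show "A *v x \<in> tail_space k"
    by simp
  show axis: "A *v axis k c = 0" for c
    using assms
    by (auto simp: matrix_vector_mult_def tail_matrices_def vec_eq_iff axis_def intro!: sum.neutral)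
  show "A *v tail k x = A *v x"
    by (simp add: tail_eq matrix_vector_simps axis)
qed

lemma adj_tail_matrices: "A \<in> tail_matrices k \<Longrightarrow> adj A \<in> tail_matrices k"
  by (simp add: tail_matrices_def adj_def)

lemma hinner_tail_left: "b \<in> tail_space k \<Longrightarrow> hinner (tail k x) b = hinner x b"
  by (simp add: tail_eq hinner_simps)

lemma tail_space_simps:
  "a \<in> tail_space k \<Longrightarrow> b \<in> tail_space k \<Longrightarrow> a + b \<in> tail_space k"
  "a \<in> tail_space k \<Longrightarrow> b \<in> tail_space k \<Longrightarrow> a - b \<in> tail_space k"
  "a \<in> tail_space k \<Longrightarrow> c *s a \<in> tail_space k"
  "a \<in> tail_space k \<Longrightarrow> - a \<in> tail_space k"
  by simp_all

text \<open>With \<open>b\<close>, \<open>d\<close> in \<open>tail_space k\<close> and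
  \<open>A\<close> in \<open>tail_matrices k\<close> the map is triangular: the tail of the image
  depends on the tail of \<open>x\<close> alone. The scale \<open>l\<close> will be 1 /
  \<alpha>.\<close>

definition siegel_affine ::
  "'n \<Rightarrow> real \<Rightarrow> complex^'n \<Rightarrow> complex \<Rightarrow> complex^'n^'n \<Rightarrow> complex^'n \<Rightarrow> complex^'n \<Rightarrow> complex^'n" where
  "siegel_affine k l b c A d x = (of_real l * x $ k + hinner x b + c) *s axis k 1 + A *v x + d"

text \<open>Translating the image adds 2 <A x + d, a>, and expressing \<open>x $ k\<close> through
  the translated point removes 2 l <x, a>; moving \<open>A\<close> across the inner product collects
  both in \<open>b'\<close>. The constants left over are those of the translation before and after
  scaling by \<open>l\<close>, and <a, b'> from the shift of the tail.\<close>

lemma heisenberg_siegel_affine: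
  fixes l t :: real
  assumes "A \<in> tail_matrices k" and "a \<in> tail_space k" and "b \<in> tail_space k" and "d \<in> tail_space k"
  defines "b' \<equiv> b - of_real (2 * l) *s a + 2 *s (adj A *v a)"
  shows "heisenberg k a t (siegel_affine k l b c A d x) =
    siegel_affine k l b'
      (c + 2 * hinner d a + of_real (1 - l) * (of_real ((norm a)\<^sup>2) + \<i> * of_real t) - hinner a b')
      A (d + a - A *v a) (heisenberg k a t x)"
proof -
  define n where "n = complex_of_real ((norm a)\<^sup>2) + \<i> * of_real t"
  define y where "y = heisenberg k a t x"
  have y: "y = x + (2 * hinner x a + n) *s axis k 1 + a"
    by (simp add: y_def heisenberg_def n_def add.assoc)
  have b': "b' \<in> tail_space k"
    unfolding b'_def using assms
    by (intro tail_space_simps tail_matrices_in_tail_space adj_tail_matrices)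
  have Ay: "A *v y = A *v x + A *v a"
    using assms(1) by (simp add: y matrix_vector_simps tail_matrices_axis)
  have yk: "y $ k = x $ k + 2 * hinner x a + n"
    using assms(2) by (simp add: y)
  have yb: "hinner y b' = hinner x b' + hinner a b'"
    using b' by (simp add: y hinner_simps)
  have xb: "hinner x b' = hinner x b - 2 * of_real l * hinner x a + 2 * hinner (A *v x) a"
    by (simp add: b'_def hinner_simps hinner_adj)
  have "heisenberg k a t (siegel_affine k l b c A d x) =
      siegel_affine k l b c A d x + (2 * (hinner (A *v x) a + hinner d a) + n) *s axis k 1 + a"
    using assms(2) by (simp add: heisenberg_def siegel_affine_def hinner_simps n_def add.assoc)
  also have "\<dots> = siegel_affine k l b'
      (c + 2 * hinner d a + of_real (1 - l) * n - hinner a b') A (d + a - A *v a) y"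
    unfolding siegel_affine_def Ay yk yb xb by (simp add: vec_eq_iff algebra_simps)
  finally show ?thesis
    by (simp add: n_def y_def)
qed

text \<open>Collects what invariance of the half-plane forces on the coefficients. It is interpreted
  for the original affine map and for a Heisenberg conjugate in each of the two cases.\<close>

locale siegel_affine_self_map =
  fixes k :: "'n :: finite" and l :: real and b :: "complex^'n" and c :: complex and A :: "complex^'n^'n"
    and d :: "complex^'n"
  assumes l_pos: "0 < l" and A: "A \<in> tail_matrices k" and b: "b \<in> tail_space k" and d: "d \<in> tail_space k"
    and self_map: "\<And>x. x \<in> siegel k \<Longrightarrow> siegel_affine k l b c A d x \<in> siegel k"
begin

lemma siegel_affine_nth: "siegel_affine k l b c A d x $ k = of_real l * x $ k + hinner x b + c"
  using tail_matrices_nth [OF A] d by (simp add: siegel_affine_def)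

lemma tail_siegel_affine: "tail k (siegel_affine k l b c A d x) = A *v x + d"
  using d by (simp add: siegel_affine_def tail_add tail_scale tail_matrices_nth [OF A])

text \<open>The boundary point (|w|^2, w) is a limit of interior points, so its image has
  nonnegative height.\<close>

lemma boundary_inequality:
  assumes w: "w \<in> tail_space k"
  shows "(norm (A *v w + d))\<^sup>2 \<le> l * (norm w)\<^sup>2 + Re (hinner w b) + Re c"
proof (rule field_le_epsilon)
  fix e :: real
  assume e: "0 < e"
  \<comment> \<open>The offset \<open>e / l\<close> above the boundary is scaled by
    \<open>l\<close>, which leaves a slack of exactly \<open>e\<close>.\<close>
  define x where "x = complex_of_real ((norm w)\<^sup>2 + e / l) *s axis k 1 + w"
  have xk: "x $ k = of_real ((norm w)\<^sup>2 + e / l)" and xw: "tail k x = w"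
    using w by (simp_all add: x_def tail_add tail_scale)
  have "x \<in> siegel k"
    using e l_pos by (simp add: siegel_def xk xw)
  then have "siegel_affine k l b c A d x \<in> siegel k"
    by (rule self_map)
  then have "(norm (A *v x + d))\<^sup>2 < Re (of_real l * x $ k + hinner x b + c)"
    by (simp add: siegel_def siegel_affine_nth tail_siegel_affine)
  moreover have "A *v x = A *v w" "hinner x b = hinner w b"
    using tail_matrices_tail [OF A, of x] hinner_tail_left [OF b, of x] by (simp_all add: xw)
  moreover have "Re (of_real l * x $ k) = l * (norm w)\<^sup>2 + e"
    using l_pos by (simp add: xk field_simps)
  ultimately show "(norm (A *v w + d))\<^sup>2 \<le> l * (norm w)\<^sup>2 + Re (hinner w b) + Re c + e"
    by simp
qed

lemma Re_translation_ge: "(norm d)\<^sup>2 \<le> Re c"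
  using boundary_inequality [of 0] by simp

text \<open>Along the real ray through \<open>w\<close>, large \<open>s\<close> isolates the
  quadratic terms, while \<open>s\<close> near 0 isolates the linear term once \<open>c\<close> and
  \<open>d\<close> vanish.\<close>

lemma scaled_boundary_inequality:
  assumes w: "w \<in> tail_space k"
  shows "(norm (of_real s *s (A *v w) + d))\<^sup>2 \<le> s\<^sup>2 * (l * (norm w)\<^sup>2) + s * Re (hinner w b) + Re c"
  using boundary_inequality [OF tail_space_simps(3) [OF w, of "of_real s"]]
  by (simp add: hinner_simps vector_scalar_commute power_mult_distrib algebra_simps)

text \<open>Letting \<^term>\<open>w\<close> tend to infinity along a ray leaves only the quadratic terms of the boundary
  inequality.\<close>

lemma norm_mult_le:
  assumes w: "w \<in> tail_space k"
  shows "(norm (A *v w))\<^sup>2 \<le> l * (norm w)\<^sup>2"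
proof (rule tendsto_le)
  show "((\<lambda>r. (norm (A *v w + r *\<^sub>R d))\<^sup>2) \<longlongrightarrow> (norm (A *v w))\<^sup>2) (at_right 0)"
    by (auto intro!: tendsto_eq_intros)
  show "((\<lambda>r. l * (norm w)\<^sup>2 + r * Re (hinner w b) + r\<^sup>2 * Re c) \<longlongrightarrow> l * (norm w)\<^sup>2) (at_right 0)"
    by (auto intro!: tendsto_eq_intros)
  \<comment> \<open>This is the scaled inequality for \<open>s = 1 / r\<close>, multiplied by the
    square of \<open>r\<close>.\<close>
  show "\<forall>\<^sub>F r in at_right 0. (norm (A *v w + r *\<^sub>R d))\<^sup>2 \<le> l * (norm w)\<^sup>2 + r * Re (hinner w b) + r\<^sup>2 * Re c"
    unfolding eventually_at_right_field
  proof (intro exI [of _ 1] conjI allI impI)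
    fix r :: real
    assume r: "0 < r"
    have "A *v w + r *\<^sub>R d = r *\<^sub>R (of_real (1 / r) *s (A *v w) + d)"
      using r by (simp add: vec_eq_iff scaleR_conv_of_real[where 'a=complex] algebra_simps)
    then have "(norm (A *v w + r *\<^sub>R d))\<^sup>2 = r\<^sup>2 * (norm (of_real (1 / r) *s (A *v w) + d))\<^sup>2"
      by (simp add: power_mult_distrib)
    also have "\<dots> \<le> r\<^sup>2 * ((1 / r)\<^sup>2 * (l * (norm w)\<^sup>2) + 1 / r * Re (hinner w b) + Re c)"
      by (intro mult_left_mono scaled_boundary_inequality w) simp
    also have "\<dots> = l * (norm w)\<^sup>2 + r * Re (hinner w b) + r\<^sup>2 * Re c"
      using r by (simp add: field_simps power2_eq_square)
    finally show "(norm (A *v w + r *\<^sub>R d))\<^sup>2 \<le> l * (norm w)\<^sup>2 + r * Re (hinner w b) + r\<^sup>2 * Re c" .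
  qed simp
qed simp

lemma norm_mult_le_sqrt: "norm (A *v v) \<le> sqrt l * norm v"
proof -
  have "(norm (A *v v))\<^sup>2 \<le> l * (norm (tail k v))\<^sup>2"
    using norm_mult_le [of "tail k v"] by (simp add: tail_matrices_tail [OF A])
  also have "\<dots> \<le> l * (norm v)\<^sup>2"
    using l_pos by (simp add: norm_eq_tail [of v k])
  finally have "sqrt ((norm (A *v v))\<^sup>2) \<le> sqrt (l * (norm v)\<^sup>2)"
    by (rule real_sqrt_le_mono)
  then show ?thesis
    by (simp add: real_sqrt_mult)
qed

text \<open>When 0 is fixed, the point \<open>w = - s b\<close> gives s^2 |A b|^2 <= s^2 l |b|^2 - s
  |b|^2. Dividing by \<open>s\<close> and letting it tend to 0 leaves 0 <= - |b|^2.\<close>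

lemma linear_part_zero:
  assumes "c = 0" and "d = 0"
  shows "b = 0"
proof -
  have "0 \<le> - (norm b)\<^sup>2"
  proof (rule tendsto_le)
    show "((\<lambda>s. s * (norm (A *v - b))\<^sup>2) \<longlongrightarrow> 0) (at_right 0)"
      by (auto intro!: tendsto_eq_intros)
    show "((\<lambda>s. s * (l * (norm b)\<^sup>2) - (norm b)\<^sup>2) \<longlongrightarrow> - (norm b)\<^sup>2) (at_right 0)"
      by (auto intro!: tendsto_eq_intros)
    show "\<forall>\<^sub>F s in at_right 0. s * (norm (A *v - b))\<^sup>2 \<le> s * (l * (norm b)\<^sup>2) - (norm b)\<^sup>2"
      unfolding eventually_at_right_field
    proof (intro exI [of _ 1] conjI allI impI)
      fix s :: real
      assume s: "0 < s"
      have "(norm (of_real s *s (A *v - b) + d))\<^sup>2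
          \<le> s\<^sup>2 * (l * (norm (- b))\<^sup>2) + s * Re (hinner (- b) b) + Re c"
        by (rule scaled_boundary_inequality) (rule tail_space_simps b)+
      then have "s * (s * (norm (A *v - b))\<^sup>2) \<le> s * (s * (l * (norm b)\<^sup>2) - (norm b)\<^sup>2)"
        by (simp add: assms hinner_self power_mult_distrib power2_eq_square algebra_simps)
      then show "s * (norm (A *v - b))\<^sup>2 \<le> s * (l * (norm b)\<^sup>2) - (norm b)\<^sup>2"
        using s by simp
    qed simp
  qed simp
  then show ?thesis
    by simp
qed

text \<open>This is the equation that cancels the linear term under a Heisenberg translation. On the
  kernel, l |a|^2 = |<A a, a>| <= sqrt l |a|^2, which forces \<open>a = 0\<close> because l > 1; in
  finite dimension injectivity gives solvability.\<close>

lemma exists_adj_resolvent: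
  assumes "1 < l"
  shows "\<exists>a\<in>tail_space k. of_real (2 * l) *s a - 2 *s (adj A *v a) = b"
proof -
  define f where "f a = of_real (2 * l) *s a - 2 *s (adj A *v a)" for a
  have lin: "linear f"
    by (rule linearI) (simp_all add: f_def vec_eq_iff matrix_vector_simps
      linear_cmul [OF matrix_vector_mul_linear] algebra_simps)
  \<comment> \<open>The \<open>k\<close>-th coordinate of \<open>f a\<close> is 2 l times that of
    \<open>a\<close>, so a solution for \<open>b\<close> in the tail space lies there too.\<close>
  have tail: "a \<in> tail_space k" if "f a \<in> tail_space k" for a
    using that assms tail_matrices_nth [OF adj_tail_matrices [OF A], of a]
    by (simp add: f_def)
  have "inj f"
    unfolding linear_injective_0 [OF lin]
  proof (intro allI impI)
    fix a
    assume fa: "f a = 0"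
    then have "of_real (2 * l) *s a = 2 *s (adj A *v a)"
      by (simp add: f_def)
    then have "cmod (hinner a (of_real (2 * l) *s a)) = cmod (hinner a (2 *s (adj A *v a)))"
      by simp
    then have "l * (norm a)\<^sup>2 = cmod (hinner (A *v a) a)"
      using assms by (simp add: hinner_simps hinner_adj hinner_self norm_mult norm_power)
    also have "\<dots> \<le> norm (A *v a) * norm a"
      by (rule norm_hinner_le)
    also have "\<dots> \<le> sqrt l * norm a * norm a"
      by (intro mult_right_mono norm_mult_le_sqrt) simp
    finally have "(l - sqrt l) * (norm a)\<^sup>2 \<le> 0"
      by (simp add: algebra_simps power2_eq_square)
    moreover have "0 < l - sqrt l"
      using assms by (simp add: real_sqrt_less_iff real_less_lsqrt power2_eq_square)
    ultimately show "a = 0"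
      by (simp add: mult_le_0_iff)
  qed
  then have "surj f"
    using linear_injective_imp_surjective [OF lin] by blast
  then obtain a where a: "f a = b"
    by (metis surjD)
  with tail b have "a \<in> tail_space k"
    by simp
  with a show ?thesis
    by (auto simp: f_def)
qed

end

section \<open>Linear fractional maps with a boundary fixed point\<close>

lemma vec_eq_tailI:
  assumes "x $ k = y $ k" and "tail k x = tail k y"
  shows "x = y"
  using assms by (auto simp: tail_eq)

text \<open>The hypothesis \<open>dilation\<close> is the value of the derivative condition at the Denjoy-Wolff point,
  once that point is moved to the basis vector.\<close>

lemma cayley_lin_frac:
  fixes M :: "complex^'n^'n" and \<alpha> :: real
  assumes nz: "\<And>z. norm z < 1 \<Longrightarrow> hinner z C + e \<noteq> 0"
    and self: "\<And>z. norm z < 1 \<Longrightarrow> norm (lin_frac M B C e z) < 1"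
    and fixed: "lin_frac M B C e (axis k 1) = axis k 1"
    and dilation: "(M *v axis k 1) $ k - cnj (C $ k) = of_real \<alpha> * (cnj (C $ k) + e)"
    and \<alpha>: "0 < \<alpha>"
  obtains b c A d where "b \<in> tail_space k" "A \<in> tail_matrices k" "d \<in> tail_space k"
    and "\<And>z. z $ k \<noteq> 1 \<Longrightarrow> hinner z C + e \<noteq> 0 \<Longrightarrow>
      cayley k (lin_frac M B C e z) = siegel_affine k (1 / \<alpha>) b c A d (cayley k z)"
proof -
  \<comment> \<open>\<open>q\<close> is the denominator of the map at the fixed point
    \<open>axis k 1\<close>. By \<open>dilation\<close>, \<open>r\<close> is the coefficient of
    \<open>1 - z $ k\<close> in the denominator after the Cayley transform.\<close>
  define q where "q = cnj (C $ k) + e"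
  define r where "r = of_real \<alpha> * q"
  \<comment> \<open>At a zero of the denominator \<open>lin_frac\<close> takes the value 0, which is
    not the fixed point.\<close>
  have q: "q \<noteq> 0"
  proof
    assume "q = 0"
    then have "axis k (1 :: complex) = 0"
      using fixed by (simp add: lin_frac_def q_def)
    then show False
      by (simp add: axis_eq_0_iff)
  qed
  then have r: "r \<noteq> 0"
    using \<alpha> by (simp add: r_def)
  have MB: "M *v axis k 1 + B = q *s axis k 1"
  proof -
    have "M *v axis k 1 + B = q *s lin_frac M B C e (axis k 1)"
      using q by (simp add: lin_frac_def q_def)
    then show ?thesis
      by (simp only: fixed)
  qed
  have MBk: "(M *v axis k 1) $ k + B $ k = q"
    using arg_cong [OF MB, of "\<lambda>v. v $ k"] by simp
  then have eB: "e - B $ k = r"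
    using dilation by (simp add: q_def r_def algebra_simps)
  have M_split: "M *v z = z $ k *s (M *v axis k 1) + M *v tail k z" for z
    by (simp add: tail_eq matrix_vector_simps)
  have C_split: "hinner z C = z $ k * cnj (C $ k) + hinner (tail k z) C" for z
    by (simp add: tail_eq hinner_simps)
  \<comment> \<open>Denominator minus \<open>k\<close>-th numerator: 1 minus the \<open>k\<close>-th
    coordinate of the image is this quantity over the denominator, so it governs the Cayley
    transform of the image.\<close>
  have denominator: "hinner z C + e - (M *v z + B) $ k =
      (1 - z $ k) * r + (hinner (tail k z) C - (M *v tail k z) $ k)" for z
  proof -
    have "hinner z C + e - (M *v z + B) $ k =
        z $ k * (cnj (C $ k) - (M *v axis k 1) $ k) + (e - B $ k)
        + (hinner (tail k z) C - (M *v tail k z) $ k)"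
      unfolding C_split [of z] M_split [of z] by (simp add: algebra_simps)
    moreover have "cnj (C $ k) - (M *v axis k 1) $ k = - r"
      using dilation by (simp add: q_def r_def algebra_simps)
    ultimately show ?thesis
      by (simp add: eB algebra_simps)
  qed
  \<comment> \<open>Otherwise the image of some point of the ball would have \<open>k\<close>-th coordinate 1.\<close>
  have no_tail: "hinner w C = (M *v w) $ k" if w: "w $ k = 0" for w
  proof (rule ccontr)
    define \<delta> where "\<delta> = hinner w C - (M *v w) $ k"
    assume "hinner w C \<noteq> (M *v w) $ k"
    then have \<delta>: "\<delta> \<noteq> 0"
      by (simp add: \<delta>_def)
    \<comment> \<open>\<open>w\<close> is rescaled so that the tail term at \<open>v\<close> equals
      \<open>- r\<close>. At \<open>z = (1 - \<epsilon>) e_k + \<epsilon> v\<close> it then cancels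
      \<open>(1 - z $ k) * r = \<epsilon> * r\<close>.\<close>
    define v where "v = (- r / \<delta>) *s w"
    \<comment> \<open>With this choice the squared norm of \<open>z\<close>, namely 1 - 2 \<epsilon>
      + \<epsilon>^2 (1 + |v|^2), is 1 - \<epsilon>.\<close>
    define \<epsilon> where "\<epsilon> = 1 / (1 + (norm v)\<^sup>2)"
    have \<epsilon>: "0 < \<epsilon>" "\<epsilon> * (1 + (norm v)\<^sup>2) = 1"
      by (auto simp: \<epsilon>_def add_pos_nonneg divide_simps add_nonneg_eq_0_iff)
    define z where "z = of_real (1 - \<epsilon>) *s axis k 1 + of_real \<epsilon> *s v"
    have vk: "v $ k = 0"
      using w by (simp add: v_def)
    then have zk: "z $ k = of_real (1 - \<epsilon>)" and zt: "tail k z = of_real \<epsilon> *s v"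
      by (simp_all add: z_def tail_add tail_diff tail_scale)
    have "(norm z)\<^sup>2 = (1 - \<epsilon>)\<^sup>2 + \<epsilon>\<^sup>2 * (norm v)\<^sup>2"
      unfolding norm_eq_tail [of z k] zk zt by (simp add: power_mult_distrib del: of_real_diff)
    also have "\<dots> = 1 - 2 * \<epsilon> + \<epsilon> * (\<epsilon> * (1 + (norm v)\<^sup>2))"
      by (simp add: power2_eq_square algebra_simps)
    also have "\<dots> < 1"
      using \<epsilon> by simp
    finally have z: "norm z < 1"
      by (simp add: abs_square_less_1)
    have "hinner v C - (M *v v) $ k = (- r / \<delta>) * \<delta>"
      unfolding v_def \<delta>_def hinner_scale_left vector_scalar_commute vector_smult_component
      by (rule right_diff_distrib [symmetric])
    then have "hinner v C - (M *v v) $ k = - r"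
      using \<delta> by simp
    then have "hinner (tail k z) C - (M *v tail k z) $ k = of_real \<epsilon> * - r"
      by (simp only: zt hinner_scale_left vector_scalar_commute vector_smult_component
          right_diff_distrib [symmetric])
    then have "hinner z C + e - (M *v z + B) $ k = 0"
      unfolding denominator zk by simp
    then have "lin_frac M B C e z $ k = 1"
      using nz [OF z] unfolding lin_frac_def vector_smult_component
      by (simp del: vector_add_component)
    then show False
      using nth_neq_1 [OF self [OF z], of k] by simp
  qed
  \<comment> \<open>The coefficients are read off from (P + Q e_k) / (u r), with \<open>P\<close>
    the numerator, \<open>Q\<close> the denominator and \<open>u = 1 - z $ k\<close>, after
    substituting 2 / u = x_k + 1 and (tail of z) / u = (tail of x) for
    \<open>x = cayley k z\<close>.\<close>
  define b where "b = cnj (2 / r) *s tail k C"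
  define c where "c = (e - cnj (C $ k)) / r - 1"
  define d where "d = (1 / r) *s tail k B"
  define f where "f w = (1 / r) *s tail k (M *v tail k w)" for w
  define A where "A = matrix f"
  have A: "A *v x = f x" for x
    unfolding A_def
    by (rule complex_linear_matrix)
      (simp_all add: f_def tail_add tail_scale matrix_vector_simps vec_eq_iff algebra_simps)
  show thesis
  proof (rule that)
    show "b \<in> tail_space k" "d \<in> tail_space k"
      by (simp_all add: b_def d_def)
    show "A \<in> tail_matrices k"
      by (simp add: tail_matrices_def A_def matrix_def f_def)
  next
    fix z :: "complex^'n"
    assume zk: "z $ k \<noteq> 1" and Q: "hinner z C + e \<noteq> 0"
    define u where "u = 1 - z $ k"
    define Q where "Q = hinner z C + e"
    define P where "P = M *v z + B"
    have u: "u \<noteq> 0" "Q \<noteq> 0"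
      using zk Q by (simp_all add: u_def Q_def)
    have QP: "P $ k = Q - u * r"
      using denominator [of z] no_tail [of "tail k z"] by (simp add: P_def Q_def u_def algebra_simps)
    \<comment> \<open>By \<open>no_tail\<close> the factor \<open>Q\<close> cancels in the Cayley
      transform of the image, leaving \<open>u\<close> times a constant as denominator, with the
      same \<open>u\<close> as in \<open>cayley k z\<close>. Hence the map becomes affine.\<close>
    have "1 - ((1 / Q) *s P) $ k = u * r / Q"
      using u by (simp add: QP field_simps)
    then have L: "cayley k (lin_frac M B C e z) = (1 / (u * r)) *s (P + Q *s axis k 1)"
      unfolding cayley_def lin_frac_def P_def [symmetric] Q_def [symmetric]
      using u r by (simp add: vec_eq_iff field_simps)
    have tB: "tail k (M *v axis k 1) = - tail k B"
      using arg_cong [OF MB, of "tail k"] by (simp add: tail_add tail_scale add_eq_0_iff2)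
    have tP: "tail k P = u *s tail k B + tail k (M *v tail k z)"
      unfolding P_def M_split [of z] by (simp add: tail_add tail_scale tB u_def vec_eq_iff algebra_simps)
    have xk: "cayley k z $ k = (2 - u) / u" and xt: "tail k (cayley k z) = (1 / u) *s tail k z"
      by (simp_all add: cayley_def u_def tail_scale tail_add flip: add_divide_distrib)
    show "cayley k (lin_frac M B C e z) = siegel_affine k (1 / \<alpha>) b c A d (cayley k z)"
    proof (rule vec_eq_tailI [where k = k])
      have "hinner (tail k z) b = 2 / r * hinner (tail k z) C"
        by (simp add: b_def hinner_scale_right hinner_diff_right tail_eq [of k C])
      moreover have "hinner (cayley k z) b = hinner (tail k (cayley k z)) b"
        by (simp add: hinner_tail_left b_def)
      ultimately have "hinner (cayley k z) b = 2 / r * (hinner (tail k z) C / u)"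
        by (simp add: xt hinner_scale_left)
      moreover have "Q = (1 - u) * cnj (C $ k) + hinner (tail k z) C + e"
        by (simp add: Q_def C_split [of z] u_def)
      moreover have "1 / of_real \<alpha> = q / r"
        using q \<alpha> by (simp add: r_def)
      ultimately show "cayley k (lin_frac M B C e z) $ k =
          siegel_affine k (1 / \<alpha>) b c A d (cayley k z) $ k"
        using u r by (simp add: L QP siegel_affine_def A f_def d_def xk c_def)
          (simp add: q_def field_simps)
      show "tail k (cayley k (lin_frac M B C e z)) =
          tail k (siegel_affine k (1 / \<alpha>) b c A d (cayley k z))"
        using u r by (simp add: L siegel_affine_def tail_add tail_scale A f_def d_def tP xt
          matrix_vector_simps vec_eq_iff field_simps)
    qed
  qed
qed

section \<open>Passing from maps of the ball to maps of the half-plane\<close>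

lemma frechet_derivative_lin_frac:
  assumes "hinner z C + e \<noteq> 0"
  shows "frechet_derivative (lin_frac M B C e) (at z) v =
    (1 / (hinner z C + e)) *s (M *v v) - (hinner v C / (hinner z C + e)\<^sup>2) *s (M *v z + B)"
proof -
  have "(lin_frac M B C e has_derivative
      (\<lambda>v. (1 / (hinner z C + e)) *s (M *v v)
        + (- (hinner v C / (hinner z C + e)\<^sup>2)) *s (M *v z + B))) (at z)"
    unfolding lin_frac_def [abs_def]
    by (rule fractional_has_derivative [OF matrix_vector_mul_linear linear_hinner assms])
  from frechet_derivative_at [OF this, symmetric] show ?thesis
    by (simp add: vec_eq_iff)
qed

lemma biholomorphic_heisenberg_cayley:
  fixes U :: "complex^'n^'n"
  assumes inner: "\<And>x y. hinner (U *v x) (U *v y) = hinner x y"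
    and UV: "\<And>x. U *v (V *v x) = x" and VU: "\<And>x. V *v (U *v x) = x" and a: "a \<in> tail_space k"
  shows "biholomorphic (ball 0 1) (siegel k) (\<lambda>z. heisenberg k a t (cayley k (U *v z)))"
proof (rule biholomorphicI [where g = "\<lambda>x. V *v cayley_inv k (heisenberg k (- a) (- t) x)"])
  have norm_U: "norm (U *v x) = norm x" for x
    using inner [of x x] by (simp add: hinner_self del: of_real_power)
  have norm_V: "norm (V *v x) = norm x" for x
    using norm_U [of "V *v x"] by (simp add: UV)
  have heis: "heisenberg k a t x \<in> siegel k \<longleftrightarrow> x \<in> siegel k"
    and heis': "heisenberg k (- a) (- t) x \<in> siegel k \<longleftrightarrow> x \<in> siegel k" for x
    using a by (simp_all add: siegel_iff siegel_height_heisenberg)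
  have holo: "holomorphic_map_on ((*v) W) S" for W :: "complex^'n^'n" and S
    using holomorphic_map_on_affine [of "(*v) W" 0] by (simp add: vector_scalar_commute)
  show "open (siegel k)"
    by (rule open_siegel)
  have "holomorphic_map_on (\<lambda>z. cayley k (U *v z)) (ball 0 1)"
    by (rule holomorphic_map_on_compose [OF holo holomorphic_cayley]) (auto simp: norm_U)
  then show "holomorphic_map_on (\<lambda>z. heisenberg k a t (cayley k (U *v z))) (ball 0 1)"
    by (rule holomorphic_map_on_compose [OF _ holomorphic_heisenberg subset_UNIV])
  have "holomorphic_map_on (\<lambda>x. cayley_inv k (heisenberg k (- a) (- t) x)) (siegel k)"
    by (rule holomorphic_map_on_compose [OF holomorphic_heisenberg holomorphic_cayley_inv])
      (auto simp: heis')
  then show "holomorphic_map_on (\<lambda>x. V *v cayley_inv k (heisenberg k (- a) (- t) x)) (siegel k)"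
    by (rule holomorphic_map_on_compose [OF _ holo subset_UNIV])
  show "heisenberg k a t (cayley k (U *v z)) \<in> siegel k" if "z \<in> ball 0 1" for z
    using that by (simp add: heis cayley_in_siegel norm_U)
  show "V *v cayley_inv k (heisenberg k (- a) (- t) x) \<in> ball 0 1" if "x \<in> siegel k" for x
    using that by (simp add: heis' norm_cayley_inv norm_V)
  show "V *v cayley_inv k (heisenberg k (- a) (- t) (heisenberg k a t (cayley k (U *v z)))) = z"
    if "z \<in> ball 0 1" for z
    using that a nth_neq_1 [of "U *v z" k]
    by (simp add: heisenberg_heisenberg cayley_inv_cayley VU norm_U)
  show "heisenberg k a t (cayley k (U *v (V *v cayley_inv k (heisenberg k (- a) (- t) x)))) = x"
    if "x \<in> siegel k" for x
    using that a heis' [of x] siegel_nth [of "heisenberg k (- a) (- t) x" k]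
      heisenberg_heisenberg [of "- a" k "- t" x]
    by (simp add: UV cayley_cayley_inv)
qed

text \<open>Surjectivity of the conjugating map carries invariance of the ball over to the
  half-plane; this supplies the assumption \<open>self_map\<close> of the locale.\<close>

lemma conjugated_on_siegel_self_map:
  assumes "conjugated_on_siegel k \<phi> \<psi>" and "\<phi> ` ball 0 1 \<subseteq> ball 0 1" and "x \<in> siegel k"
  shows "\<psi> x \<in> siegel k"
proof -
  obtain \<sigma> where \<sigma>: "bij_betw \<sigma> (ball 0 1) (siegel k)" "\<forall>z\<in>ball 0 1. \<sigma> (\<phi> z) = \<psi> (\<sigma> z)"
    using assms(1) by (auto simp: conjugated_on_siegel_def biholomorphic_def)
  obtain z where z: "z \<in> ball 0 1" "x = \<sigma> z"
    using \<sigma>(1) assms(3) by (metis bij_betw_imp_surj_on imageE)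
  then have "\<phi> z \<in> ball 0 1"
    using assms(2) by blast
  then have "\<sigma> (\<phi> z) \<in> siegel k"
    using \<sigma>(1) by (metis bij_betwE)
  then show ?thesis
    using \<sigma>(2) z by simp
qed

section \<open>The normal forms with one and with two boundary fixed points\<close>

lemma scaleR_matrix_vector_mult:
  fixes A :: "complex^'n^'n"
  shows "(r *\<^sub>R A) *v x = complex_of_real r *s (A *v x)"
  by (simp add: vec_eq_iff matrix_vector_mult_def scaleR_conv_of_real [where 'a = complex]
    sum_distrib_left mult.assoc)

lemma scaleR_tail_matrices: "A \<in> tail_matrices k \<Longrightarrow> r *\<^sub>R A \<in> tail_matrices k"
  by (simp add: tail_matrices_def)

theorem proposition3p1:
  fixes \<phi> :: "complex^'n \<Rightarrow> complex^'n" and \<alpha> :: real and k :: 'n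
  assumes "linear_fractional_self_map \<phi>" and "hyperbolic \<phi> \<alpha>"
  shows "(card (boundary_fixed_points \<phi>) = 1 \<longrightarrow>
            (\<exists>(c::real) d A. d \<in> tail_space k \<and> A \<in> tail_matrices k \<and>
               \<alpha> * c \<ge> (norm d)\<^sup>2 \<and> onorm (\<lambda>v. A *v v) \<le> sqrt \<alpha> \<and>
               conjugated_on_siegel k \<phi>
                 (\<lambda>x. complex_of_real (1 / \<alpha>) *s
                       join k (x $ k + complex_of_real c) (A *v tail k x + d)))) \<and>
         (card (boundary_fixed_points \<phi>) = 2 \<longrightarrow>
            (\<exists>A. A \<in> tail_matrices k \<and> onorm (\<lambda>v. A *v v) \<le> 1 \<and>
               conjugated_on_siegel k \<phi>
                 (\<lambda>x. join k (x $ k / complex_of_real \<alpha>)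
                       (complex_of_real (1 / sqrt \<alpha>) *s (A *v tail k x)))))"
proof -
  obtain M B C e where \<phi>: "\<phi> = lin_frac M B C e"
    and nz: "\<And>z. norm z < 1 \<Longrightarrow> hinner z C + e \<noteq> 0" and self: "\<phi> ` ball 0 1 \<subseteq> ball 0 1"
    using assms(1) by (auto simp: linear_fractional_self_map_def)
  obtain \<tau> where \<tau>: "norm \<tau> = 1" "\<phi> \<tau> = \<tau>"
    and dilation: "hinner (frechet_derivative \<phi> (at \<tau>) \<tau>) \<tau> = complex_of_real \<alpha>"
    and \<alpha>: "0 < \<alpha>" "\<alpha> < 1"
    using assms(2) by (auto simp: hyperbolic_def denjoy_wolff_point_def)
  \<comment> \<open>A zero of the denominator is sent to 0, so it cannot be a fixed point of norm
    1.\<close>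
  have pole: "hinner \<zeta> C + e \<noteq> 0" if "norm \<zeta> = 1" "\<phi> \<zeta> = \<zeta>" for \<zeta>
    using that by (auto simp: \<phi> lin_frac_def)
  obtain U where inner: "\<And>x y. hinner (U *v x) (U *v y) = hinner x y" and U\<tau>: "U *v \<tau> = axis k 1"
    and UV: "\<And>x. U *v (adj U *v x) = x" and VU: "\<And>x. adj U *v (U *v x) = x"
    using exists_unitary [OF \<tau>(1), of k] by blast
  have norm_U: "norm (U *v x) = norm x" for x
    using inner [of x x] by (simp add: hinner_self del: of_real_power)
  have norm_V: "norm (adj U *v x) = norm x" for x
    using norm_U [of "adj U *v x"] by (simp add: UV)
  have inner_V: "hinner x (U *v y) = hinner (adj U *v x) y" for x y
    using inner [of "adj U *v x" y] by (simp add: UV)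

  define M' where "M' = U ** M ** adj U"
  have M': "M' *v x = U *v (M *v (adj U *v x))" for x
    by (simp add: M'_def matrix_vector_mul_assoc matrix_mul_assoc)
  have conj: "lin_frac M' (U *v B) (U *v C) e (U *v z) = U *v \<phi> z" for z
    by (simp add: lin_frac_def \<phi> M' inner VU vector_scalar_commute matrix_vector_right_distrib)
  define q where "q = hinner \<tau> C + e"
  have q: "q \<noteq> 0"
    using pole [OF \<tau>] by (simp add: q_def)
  then have "M *v \<tau> + B = q *s \<phi> \<tau>"
    by (simp add: \<phi> lin_frac_def q_def)
  then have \<tau>_eq: "M *v \<tau> + B = q *s \<tau>"
    by (simp only: \<tau>(2))
  \<comment> \<open>The quotient rule at \<tau>, with numerator \<open>q *s \<tau>\<close>, turns
    the dilation condition into <M \<tau>, \<tau>> - <\<tau>, C> = \<alpha> q.\<close>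
  have "frechet_derivative \<phi> (at \<tau>) \<tau> = (1 / q) *s (M *v \<tau>) - (hinner \<tau> C / q\<^sup>2) *s (q *s \<tau>)"
    unfolding \<phi> frechet_derivative_lin_frac [OF pole [OF \<tau>]] q_def [symmetric] \<tau>_eq ..
  then have "of_real \<alpha> = hinner (M *v \<tau>) \<tau> / q - hinner \<tau> C / q"
    using q \<tau>(1) dilation by (simp add: hinner_simps hinner_self power2_eq_square)
  then have "hinner (M *v \<tau>) \<tau> - hinner \<tau> C = of_real \<alpha> * (hinner \<tau> C + e)"
    unfolding q_def [symmetric] using q by (simp add: field_simps)
  moreover have "(M' *v axis k 1) $ k = hinner (M *v \<tau>) \<tau>"
    by (simp add: M' flip: U\<tau> hinner_axis_right) (simp add: VU inner)
  moreover have "cnj ((U *v C) $ k) = hinner \<tau> C"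
    by (simp add: inner flip: U\<tau> hinner_axis_left)
  ultimately have dilation':
    "(M' *v axis k 1) $ k - cnj ((U *v C) $ k) = of_real \<alpha> * (cnj ((U *v C) $ k) + e)"
    by simp

  obtain b c A d where b: "b \<in> tail_space k" and A: "A \<in> tail_matrices k" and d: "d \<in> tail_space k"
    and aff: "\<And>z. z $ k \<noteq> 1 \<Longrightarrow> hinner z (U *v C) + e \<noteq> 0 \<Longrightarrow>
      cayley k (lin_frac M' (U *v B) (U *v C) e z) = siegel_affine k (1 / \<alpha>) b c A d (cayley k z)"
  proof (rule cayley_lin_frac [OF _ _ _ dilation' \<alpha>(1)])
    show "hinner z (U *v C) + e \<noteq> 0" if "norm z < 1" for z
      using nz [of "adj U *v z"] that by (simp add: inner_V norm_V)
    show "norm (lin_frac M' (U *v B) (U *v C) e z) < 1" if "norm z < 1" for z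
      using self that conj [of "adj U *v z"] by (auto simp: UV norm_U norm_V image_subset_iff)
    show "lin_frac M' (U *v B) (U *v C) e (axis k 1) = axis k 1"
      using conj [of \<tau>] by (simp add: U\<tau> \<tau>(2))
  qed blast

  \<comment> \<open>Coefficients after conjugation by the translation with parameters
    \<open>a\<close> and \<open>t\<close>; 1 / \<alpha> and \<open>A\<close> do not change. Each
    case makes its own choice of \<open>a\<close> and \<open>t\<close>.\<close>
  define b' where "b' a = b - of_real (2 * (1 / \<alpha>)) *s a + 2 *s (adj A *v a)" for a
  define c' where "c' a t = c + 2 * hinner d a
      + of_real (1 - 1 / \<alpha>) * (of_real ((norm a)\<^sup>2) + \<i> * of_real t) - hinner a (b' a)" for a and t :: real
  define d' where "d' a = d + a - A *v a" for a
  have heis: "heisenberg k a t (siegel_affine k (1 / \<alpha>) b c A d x) =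
      siegel_affine k (1 / \<alpha>) (b' a) (c' a t) A (d' a) (heisenberg k a t x)"
    if "a \<in> tail_space k" for a t x
    unfolding b'_def c'_def d'_def by (rule heisenberg_siegel_affine [OF A that b d])
  have conjugated: "conjugated_on_siegel k \<phi> (siegel_affine k (1 / \<alpha>) (b' a) (c' a t) A (d' a))"
    if a: "a \<in> tail_space k" for a t
    unfolding conjugated_on_siegel_def
  proof (intro exI conjI ballI)
    show "biholomorphic (ball 0 1) (siegel k) (\<lambda>z. heisenberg k a t (cayley k (U *v z)))"
      by (rule biholomorphic_heisenberg_cayley [OF inner UV VU a])
    show "heisenberg k a t (cayley k (U *v \<phi> z)) =
        siegel_affine k (1 / \<alpha>) (b' a) (c' a t) A (d' a) (heisenberg k a t (cayley k (U *v z)))"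
      if "z \<in> ball 0 1" for z
      using that aff [of "U *v z"] nz [of z] nth_neq_1 [of "U *v z" k]
      by (simp add: heis [OF a, symmetric] conj inner norm_U)
  qed
  have self_map: "siegel_affine_self_map k (1 / \<alpha>) (b' a) (c' a t) A (d' a)"
    if a: "a \<in> tail_space k" for a t
  proof
    show "b' a \<in> tail_space k" "d' a \<in> tail_space k"
      using a b d tail_matrices_nth [OF adj_tail_matrices [OF A]] tail_matrices_nth [OF A]
      by (simp_all add: b'_def d'_def)
  qed (use A \<alpha> conjugated_on_siegel_self_map [OF conjugated [OF a] self] in auto)
  interpret base: siegel_affine_self_map k "1 / \<alpha>" b c A d
    using self_map [of 0 0] by (simp add: b'_def c'_def d'_def)

  show ?thesis
  proof (intro conjI impI)
    \<comment> \<open>The resolvent equation applies because 1 / \<alpha> > 1, and it says that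
      \<open>b' a = 0\<close>.\<close>
    obtain a where a: "a \<in> tail_space k" and "b' a = 0"
      using base.exists_adj_resolvent \<alpha> by (auto simp: b'_def)
    \<comment> \<open>Once \<open>b' a = 0\<close>, the imaginary part of \<open>c' a t\<close> is
      that of c + 2 <d, a> plus (1 - 1 / \<alpha>) t, and this \<open>t\<close> cancels it.\<close>
    define t where "t = Im (c + 2 * hinner d a) / (1 / \<alpha> - 1)"
    interpret siegel_affine_self_map k "1 / \<alpha>" "b' a" "c' a t" A "d' a"
      by (rule self_map [OF a])
    have "Im (c' a t) = 0"
      using \<alpha> by (simp add: c'_def \<open>b' a = 0\<close> t_def field_simps)
    then have c': "c' a t = of_real (Re (c' a t))"
      by (simp add: complex_eq_iff)
    show "\<exists>(c::real) d A. d \<in> tail_space k \<and> A \<in> tail_matrices k \<and>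
        \<alpha> * c \<ge> (norm d)\<^sup>2 \<and> onorm (\<lambda>v. A *v v) \<le> sqrt \<alpha> \<and>
        conjugated_on_siegel k \<phi> (\<lambda>x. complex_of_real (1 / \<alpha>) *s
          join k (x $ k + complex_of_real c) (A *v tail k x + d))"
    \<comment> \<open>Pulling out the factor 1 / \<alpha> multiplies \<open>c' a t\<close>,
      \<open>d' a\<close> and \<open>A\<close> by \<alpha>. The bound |d|^2 <= Re c becomes the
      stated one, and the norm bound becomes \<alpha> sqrt (1 / \<alpha>) = sqrt \<alpha>.\<close>
    proof (intro exI conjI)
      show "complex_of_real \<alpha> *s d' a \<in> tail_space k"
        using d by simp
      show "\<alpha> *\<^sub>R A \<in> tail_matrices k"
        by (rule scaleR_tail_matrices [OF A])
      show "(norm (complex_of_real \<alpha> *s d' a))\<^sup>2 \<le> \<alpha> * (\<alpha> * Re (c' a t))"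
        using Re_translation_ge \<alpha> by (simp add: power_mult_distrib power2_eq_square)
      show "onorm (\<lambda>v. (\<alpha> *\<^sub>R A) *v v) \<le> sqrt \<alpha>"
      proof (rule onorm_le)
        fix v
        have "norm ((\<alpha> *\<^sub>R A) *v v) \<le> \<alpha> * (sqrt (1 / \<alpha>) * norm v)"
          using norm_mult_le_sqrt [of v] \<alpha> by (simp add: scaleR_matrix_vector_mult)
        also have "\<dots> = sqrt \<alpha> * norm v"
          using \<alpha> real_div_sqrt [of \<alpha>] by (simp add: real_sqrt_divide field_simps)
        finally show "norm ((\<alpha> *\<^sub>R A) *v v) \<le> sqrt \<alpha> * norm v" .
      qed
      have normal_form: "siegel_affine k (1 / \<alpha>) (b' a) (c' a t) A (d' a) x = complex_of_real (1 / \<alpha>) *s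
          join k (x $ k + complex_of_real (\<alpha> * Re (c' a t)))
            ((\<alpha> *\<^sub>R A) *v tail k x + complex_of_real \<alpha> *s d' a)" for x
      proof -
        have "(\<alpha> *\<^sub>R A) *v tail k x = complex_of_real \<alpha> *s (A *v x)"
          by (simp add: scaleR_matrix_vector_mult tail_matrices_tail [OF A])
        then show ?thesis
          using \<alpha> d by (subst c') (simp add: siegel_affine_def \<open>b' a = 0\<close> join_def vec_eq_iff
            axis_def tail_matrices_nth [OF A] field_simps)
      qed
      show "conjugated_on_siegel k \<phi> (\<lambda>x. complex_of_real (1 / \<alpha>) *s
          join k (x $ k + complex_of_real (\<alpha> * Re (c' a t)))
            ((\<alpha> *\<^sub>R A) *v tail k x + complex_of_real \<alpha> *s d' a))"
        by (rule back_subst [of "conjugated_on_siegel k \<phi>", OF conjugated [OF a, of t]])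
          (rule ext, rule normal_form)
    qed
  next
    assume "card (boundary_fixed_points \<phi>) = 2"
    moreover have "\<tau> \<in> boundary_fixed_points \<phi>"
      using \<tau> by (simp add: boundary_fixed_points_def)
    ultimately obtain \<zeta> where "\<zeta> \<in> boundary_fixed_points \<phi>" and \<zeta>\<tau>: "\<zeta> \<noteq> \<tau>"
      by (auto simp: card_2_iff)
    then have \<zeta>: "norm \<zeta> = 1" "\<phi> \<zeta> = \<zeta>"
      by (simp_all add: boundary_fixed_points_def)
    \<comment> \<open>The second fixed point is off the pole of the Cayley transform: a unit vector
      with \<open>k\<close>-th coordinate 1 has zero tail and so equals
      \<open>U *v \<tau>\<close>.\<close>
    have \<zeta>k: "(U *v \<zeta>) $ k \<noteq> 1"
    proof
      assume "(U *v \<zeta>) $ k = 1"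
      moreover from this have "tail k (U *v \<zeta>) = 0"
        using norm_eq_tail [of "U *v \<zeta>" k] by (simp add: norm_U \<zeta>)
      ultimately have "U *v \<zeta> = U *v \<tau>"
        by (simp add: U\<tau> tail_eq)
      with \<zeta>\<tau> VU show False
        by metis
    qed
    define p where "p = cayley k (U *v \<zeta>)"
    \<comment> \<open>The identity \<open>aff\<close> holds wherever both denominators are nonzero,
      hence also at this boundary point.\<close>
    have p_fixed: "siegel_affine k (1 / \<alpha>) b c A d p = p"
      using aff [OF \<zeta>k] pole [OF \<zeta>] by (simp add: p_def conj inner \<zeta>)
    have "siegel_height k p = 0"
      by (simp add: p_def siegel_height_cayley [OF \<zeta>k] norm_U \<zeta>)
    then have pk: "Re (p $ k) = (norm (tail k p))\<^sup>2"
      by (simp add: siegel_height_def)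
    \<comment> \<open>These parameters move \<open>p\<close> to the origin: at height 0, 2 <p, a> +
      |a|^2 equals - |tail p|^2 = - Re p_k, and \<open>t\<close> removes the imaginary part.\<close>
    define a where "a = - tail k p"
    define t where "t = - Im (p $ k)"
    have a: "a \<in> tail_space k"
      by (simp add: a_def)
    have "hinner p (tail k p) = of_real (Re (p $ k))"
      unfolding pk using hinner_tail_left [of "tail k p" k p] hinner_self [of "tail k p"] by simp
    then have "2 * hinner p a + of_real ((norm a)\<^sup>2) + \<i> * of_real t =
        - (of_real (Re (p $ k)) + \<i> * of_real (Im (p $ k)))"
      by (simp add: a_def t_def flip: pk)
    also have "\<dots> = - (p $ k)"
      by (simp only: complex_eq [symmetric])
    finally have "heisenberg k a t p = p + (- (p $ k)) *s axis k 1 + a"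
      by (simp only: heisenberg_def)
    also have "\<dots> = 0"
      unfolding a_def tail_eq [of k p] by simp
    finally have p_zero: "heisenberg k a t p = 0" .
    then have "siegel_affine k (1 / \<alpha>) (b' a) (c' a t) A (d' a) 0 = 0"
      using heis [OF a, of t p] unfolding p_fixed p_zero by simp
    then have zero: "c' a t *s axis k 1 + d' a = 0"
      by (simp add: siegel_affine_def)
    interpret siegel_affine_self_map k "1 / \<alpha>" "b' a" "c' a t" A "d' a"
      by (rule self_map [OF a])
    have "c' a t = 0"
      using arg_cong [OF zero, of "\<lambda>v. v $ k"] d by simp
    moreover from this have "d' a = 0"
      using zero by simp
    ultimately have "b' a = 0"
      by (rule linear_part_zero)
    show "\<exists>A. A \<in> tail_matrices k \<and> onorm (\<lambda>v. A *v v) \<le> 1 \<and>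
        conjugated_on_siegel k \<phi> (\<lambda>x. join k (x $ k / complex_of_real \<alpha>)
          (complex_of_real (1 / sqrt \<alpha>) *s (A *v tail k x)))"
    \<comment> \<open>The factor sqrt \<alpha> turns the bound sqrt (1 / \<alpha>) on the norm of
      \<open>A\<close> into 1.\<close>
    proof (intro exI conjI)
      show "sqrt \<alpha> *\<^sub>R A \<in> tail_matrices k"
        by (rule scaleR_tail_matrices [OF A])
      show "onorm (\<lambda>v. (sqrt \<alpha> *\<^sub>R A) *v v) \<le> 1"
      proof (rule onorm_le)
        fix v
        have "norm ((sqrt \<alpha> *\<^sub>R A) *v v) \<le> sqrt \<alpha> * (sqrt (1 / \<alpha>) * norm v)"
          using norm_mult_le_sqrt [of v] \<alpha> by (simp add: scaleR_matrix_vector_mult)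
        also have "\<dots> = 1 * norm v"
          using \<alpha> by (simp add: real_sqrt_divide)
        finally show "norm ((sqrt \<alpha> *\<^sub>R A) *v v) \<le> 1 * norm v" .
      qed
      have normal_form: "siegel_affine k (1 / \<alpha>) (b' a) (c' a t) A (d' a) x =
          join k (x $ k / complex_of_real \<alpha>)
            (complex_of_real (1 / sqrt \<alpha>) *s ((sqrt \<alpha> *\<^sub>R A) *v tail k x))" for x
      proof -
        have "(sqrt \<alpha> *\<^sub>R A) *v tail k x = complex_of_real (sqrt \<alpha>) *s (A *v x)"
          by (simp add: scaleR_matrix_vector_mult tail_matrices_tail [OF A])
        then show ?thesis
          using \<alpha> by (simp add: siegel_affine_def \<open>b' a = 0\<close> \<open>c' a t = 0\<close> \<open>d' a = 0\<close> join_def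
            vec_eq_iff axis_def tail_matrices_nth [OF A])
      qed
      show "conjugated_on_siegel k \<phi> (\<lambda>x. join k (x $ k / complex_of_real \<alpha>)
          (complex_of_real (1 / sqrt \<alpha>) *s ((sqrt \<alpha> *\<^sub>R A) *v tail k x)))"
        by (rule back_subst [of "conjugated_on_siegel k \<phi>", OF conjugated [OF a, of t]])
          (rule ext, rule normal_form)
    qed
  qed
qed

end
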